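(* Let $a$ and $b$ be relatively prime positive integers and let $n$ be a nonnegative integer. Then the number of zero-sum words of length $(a+b)n$ in the alphabet $\{+a,-b\}$ that contain no illegal subword is $\binom{a+b}{a}^n$.
   Context: A word in the alphabet $\{+a,-b\}$ is a finite sequence $w=w_1w_2\cdots w_m$ with each $w_i\in\{+a,-b\}$; it is zero-sum if $\sum_i w_i=0$. A consecutive subword $w_iw_{i+1}\cdots w_j$ ($1\le i\le j\le m$) of $w$ is called illegal if it is zero-sum, its first letter $w_i$ is $+a$, and the letter immediately following it in $w$ exists and equals $-b$ (i.e. $j<m$ and $w_{j+1}=-b$). *)

theory Defs
  imports Complex_Main
begin

definition words :: "nat \<Rightarrow> nat \<Rightarrow> int list set" where
  "words a b = lists {int a, - int b}"

definition zero_sum :: "int list \<Rightarrow> bool" where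
  "zero_sum w \<longleftrightarrow> sum_list w = 0"

text \<open>Positions are 0-based: \<open>subword w i j\<close> consists of the letters \<open>w ! i, \<dots>, w ! j\<close>
  when \<open>i \<le> j\<close> and \<open>j < length w\<close>.\<close>

definition subword :: "int list \<Rightarrow> nat \<Rightarrow> nat \<Rightarrow> int list" where
  "subword w i j = take (Suc j - i) (drop i w)"

definition illegal_at :: "nat \<Rightarrow> nat \<Rightarrow> int list \<Rightarrow> nat \<Rightarrow> nat \<Rightarrow> bool" where
  "illegal_at a b w i j \<longleftrightarrow>
     i \<le> j \<and> zero_sum (subword w i j) \<and> w ! i = int a \<and>
     Suc j < length w \<and> w ! Suc j = - int b"

end

theory Submission
  imports Defs
begin

text \<open>
  Put \<open>N = a + b\<close> and let \<open>H\<close> be the prefix sums of a word. Since \<open>H t \<equiv> a t\<close> modulo \<open>N\<close>, every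
  zero-sum subword has length \<open>N k\<close>, and \<open>H (t + N k) - H t\<close> is a multiple of \<open>N\<close> that changes by
  at most \<open>N\<close> when \<open>t\<close> grows by one. Hence a word has no illegal subword iff, for each \<open>k\<close>, these
  differences never become negative again after having been nonnegative.

  Legal words of length \<open>N (n + 1)\<close> correspond bijectively to pairs of a legal word \<open>w\<close> of length
  \<open>N n\<close> and one of the \<open>(a + b) choose a\<close> zero-sum words \<open>g\<close> of length \<open>N\<close>. Let \<open>G\<close> be the prefix
  sums of the periodic word \<open>g g g \<dots>\<close> and \<open>s\<close> the first position at which \<open>H - G\<close> is minimal.
  Insert at position \<open>s\<close> of \<open>w\<close> the rotation of \<open>g\<close> that starts at phase \<open>s\<close>. In the resulting word \<open>s\<close>
  is recognised as the first position with \<open>H s \<le> H (s + N)\<close>, so the insertion can be undone, and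
  the minimality of \<open>s\<close> is exactly what makes the new word legal.
\<close>

section \<open>Prefix sums, settled functions and first minima\<close>

definition height :: "int list \<Rightarrow> nat \<Rightarrow> int" where
  "height w t = (\<Sum>i<t. w ! i)"

definition periodic_height :: "int list \<Rightarrow> nat \<Rightarrow> int" where
  "periodic_height g t = (\<Sum>i<t. g ! (i mod length g))"

text \<open>Stated for arbitrary functions, so that the splicing argument involves no lists.
  Comparing any two positions \<open>t\<close> and \<open>t'\<close>, not just neighbours, lets a
  nonnegative difference be carried over any distance at once.\<close>

definition settled :: "nat \<Rightarrow> (nat \<Rightarrow> int) \<Rightarrow> nat \<Rightarrow> bool" where
  "settled N H M \<longleftrightarrow> (\<forall>k t t'. t \<le> t' \<longrightarrow> t' + N * k \<le> M \<longrightarrow>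
     H t \<le> H (t + N * k) \<longrightarrow> H t' \<le> H (t' + N * k))"

definition first_min :: "(nat \<Rightarrow> int) \<Rightarrow> nat \<Rightarrow> nat \<Rightarrow> bool" where
  "first_min D M s \<longleftrightarrow> s \<le> M \<and> (\<forall>t<s. D s < D t) \<and> (\<forall>t\<le>M. D s \<le> D t)"

text \<open>Prefix sums of the word obtained by inserting a loop with (periodic) prefix sums \<open>G\<close> at
  position \<open>s\<close> of a word with prefix sums \<open>H\<close>.\<close>

definition spliced :: "nat \<Rightarrow> (nat \<Rightarrow> int) \<Rightarrow> (nat \<Rightarrow> int) \<Rightarrow> nat \<Rightarrow> nat \<Rightarrow> int" where
  "spliced N H G s p =
     (if p \<le> s then H p else if p \<le> s + N then H s + G p - G s else H (p - N))"

text \<open>Rotating by \<open>s\<close> puts the letter \<open>g ! (p mod length g)\<close> at each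
  position \<open>p\<close> of the loop. The loop thus follows the fixed function
  \<open>periodic_height g\<close> wherever it is inserted, and the function minimised to find
  \<open>s\<close> does not itself depend on \<open>s\<close>.\<close>

definition insert_loop :: "nat \<Rightarrow> 'a list \<Rightarrow> 'a list \<Rightarrow> 'a list" where
  "insert_loop s g w = take s w @ rotate s g @ drop s w"

lemma settledD:
  assumes "settled N H M" "t \<le> t'" "t' + N * k \<le> M" "H t \<le> H (t + N * k)"
  shows "H t' \<le> H (t' + N * k)"
  using assms unfolding settled_def by blast

lemma settledI:
  assumes "\<And>k t t'. 0 < k \<Longrightarrow> t \<le> t' \<Longrightarrow> t' + N * k \<le> M \<Longrightarrow> H t \<le> H (t + N * k)
    \<Longrightarrow> H t' \<le> H (t' + N * k)"
  shows "settled N H M"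
  unfolding settled_def
proof (intro allI impI)
  fix k t t' assume "t \<le> t'" "t' + N * k \<le> M" "H t \<le> H (t + N * k)"
  then show "H t' \<le> H (t' + N * k)" using assms[of k t t'] by (cases "k = 0") auto
qed

lemma settled_cong:
  assumes "\<And>p. p \<le> M \<Longrightarrow> H p = H' p"
  shows "settled N H M \<longleftrightarrow> settled N H' M"
proof -
  have "H t = H' t" "H (t + N * k) = H' (t + N * k)" "H t' = H' t'" "H (t' + N * k) = H' (t' + N * k)"
    if "t \<le> t'" "t' + N * k \<le> M" for t t' k using that by (auto intro!: assms)
  then show ?thesis unfolding settled_def by metis
qed

lemma ex_first_min: "\<exists>s. first_min D M s"
proof -
  obtain s0 where s0: "s0 \<le> M" "\<And>t. t \<le> M \<Longrightarrow> D s0 \<le> D t"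
    using ex_is_arg_min_if_finite[of "{..M}" D] unfolding is_arg_min_linorder by auto
  define s where "s = (LEAST t. t \<le> M \<and> D t = D s0)"
  have s: "s \<le> M \<and> D s = D s0" unfolding s_def by (rule LeastI[of _ s0]) (simp add: s0)
  have "D s < D t" if "t < s" for t
  proof -
    have "\<not> (t \<le> M \<and> D t = D s0)" using not_less_Least[OF that[unfolded s_def]] .
    with that s s0(2)[of t] show ?thesis by auto
  qed
  with s s0 show ?thesis unfolding first_min_def by (intro exI[of _ s]) auto
qed

lemma first_min_unique: "first_min D M s \<Longrightarrow> first_min D M s' \<Longrightarrow> s = s'"
  unfolding first_min_def by (metis linorder_neqE_nat not_less)

section \<open>Splicing a loop at the first minimum keeps a function settled\<close>

definition periodic :: "nat \<Rightarrow> (nat \<Rightarrow> 'a) \<Rightarrow> bool" where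
  "periodic N G \<longleftrightarrow> (\<forall>t. G (t + N) = G t)"

lemma periodic_mult:
  assumes "periodic N G"
  shows "G (t + N * k) = G t"
proof (induction k)
  case (Suc k)
  have "G (t + N * Suc k) = G ((t + N * k) + N)" by (simp add: algebra_simps)
  with Suc assms show ?case by (simp add: periodic_def)
qed simp

lemma spliced_low: "p \<le> s \<Longrightarrow> spliced N H G s p = H p"
  by (simp add: spliced_def)

lemma spliced_mid:
  "s \<le> p \<Longrightarrow> p \<le> s + N \<Longrightarrow> spliced N H G s p = H s + G p - G s"
  by (cases "p = s") (simp_all add: spliced_def)

lemma spliced_high:
  assumes "periodic N G" and "s \<le> p"
  shows "spliced N H G s (p + N) = H p"
  using assms by (cases "p = s") (auto simp: spliced_def periodic_def)

text \<open>If \<open>t + N * k\<close> is still at most \<open>s\<close>, a failure would be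
  carried by settledness to the pair ending at \<open>s\<close>; as \<open>G\<close> agrees at
  \<open>s - N * k\<close> and \<open>s\<close>, the minimum would occur earlier. Otherwise
  \<open>t + N * k\<close> lies in the loop, and the claim is the strict minimality of
  \<open>s\<close> against \<open>t\<close>.\<close>

lemma spliced_before_first_min:
  fixes H G :: "nat \<Rightarrow> int"
  assumes per: "periodic N G"
    and S: "settled N H M" and fm: "first_min (\<lambda>t. H t - G t) M s"
    and N: "0 < N" and k: "0 < k" and t: "t < s" "t + N * k \<le> s + N"
  shows "spliced N H G s (t + N * k) < spliced N H G s t"
proof (cases "t + N * k \<le> s")
  case True
  have "H (t + N * k) < H t"
  proof (rule ccontr)
    assume "\<not> ?thesis"
    then have le: "H t \<le> H (t + N * k)" by simp
    have "H (s - N * k) \<le> H (s - N * k + N * k)"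
      by (rule settledD[OF S, of t]) (use True fm le in \<open>auto simp: first_min_def\<close>)
    moreover have "G (s - N * k + N * k) = G (s - N * k)" by (rule periodic_mult[OF per])
    moreover have "s - N * k + N * k = s" using True by simp
    moreover have "s - N * k < s" using N k t by simp
    ultimately show False using fm unfolding first_min_def by fastforce
  qed
  with True t show ?thesis by (simp add: spliced_low)
next
  case False
  have "spliced N H G s (t + N * k) = H s + G t - G s"
    using False t by (subst spliced_mid) (auto simp: periodic_mult[OF per])
  moreover have "H s - G s < H t - G t" using fm t unfolding first_min_def by auto
  ultimately show ?thesis using t by (simp add: spliced_low)
qed

text \<open>The right end always lies beyond the loop and carries the value of \<open>H\<close> at
  \<open>t + N * (k - 1)\<close>. For \<open>t\<close> inside the loop the inequality is minimality
  of \<open>s\<close> against that position; for \<open>t\<close> beyond the loop it follows from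
  settledness of \<open>H\<close>.\<close>

lemma spliced_after_first_min:
  fixes H G :: "nat \<Rightarrow> int"
  assumes per: "periodic N G"
    and S: "settled N H M" and fm: "first_min (\<lambda>t. H t - G t) M s"
    and k: "0 < k" and t: "s \<le> t" "t + N * k \<le> M + N"
  shows "spliced N H G s t \<le> spliced N H G s (t + N * k)"
proof -
  obtain j where j: "k = Suc j" using k by (cases k) auto
  have e: "t + N * k = (t + N * j) + N" by (simp add: j)
  have top: "spliced N H G s (t + N * k) = H (t + N * j)"
    unfolding e using t by (intro spliced_high[OF per]) auto
  show ?thesis
  proof (cases "t \<le> s + N")
    case True
    have "H s - G s \<le> H (t + N * j) - G (t + N * j)"
      using fm t e unfolding first_min_def by auto
    then show ?thesis using True t by (simp add: top spliced_mid periodic_mult[OF per])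
  next
    case False
    define u where "u = t - N"
    have u: "t = u + N" "s \<le> u" using False by (auto simp: u_def)
    have uM: "u + N * k \<le> M" using t u by simp
    have "H u \<le> H (u + N * k)"
    proof (rule ccontr)
      assume "\<not> ?thesis"
      \<comment> \<open>A descent at \<open>u\<close> forces one at the earlier position
        \<open>s\<close>, but there the periodic part cancels and minimality forbids it.\<close>
      then have "\<not> H s \<le> H (s + N * k)" using settledD[OF S \<open>s \<le> u\<close> uM] by blast
      moreover have "H s - G s \<le> H (s + N * k) - G (s + N * k)"
        using fm uM u unfolding first_min_def by auto
      ultimately show False by (simp add: periodic_mult[OF per])
    qed
    moreover have "t + N * j = u + N * k" using u j by simp
    moreover have "spliced N H G s t = H u" unfolding u(1) by (rule spliced_high[OF per u(2)])
    ultimately show ?thesis using top by simp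
  qed
qed

lemma settled_spliced:
  fixes H G :: "nat \<Rightarrow> int"
  assumes per: "periodic N G" and N: "0 < N"
    and S: "settled N H M" and fm: "first_min (\<lambda>t. H t - G t) M s"
  shows "settled N (spliced N H G s) (M + N)"
proof (rule settledI)
  fix k t t' :: nat
  let ?S = "spliced N H G s"
  assume k: "0 < k" and tt: "t \<le> t'" and t': "t' + N * k \<le> M + N" and le: "?S t \<le> ?S (t + N * k)"
  show "?S t' \<le> ?S (t' + N * k)"
  proof (cases "s \<le> t'")
    case True
    then show ?thesis using spliced_after_first_min[OF per S fm k True t'] by blast
  next
    case False
    obtain j where j: "k = Suc j" using k by (cases k) auto
    \<comment> \<open>A pair starting before \<open>s\<close> and ending no later than the loop
      would drop strictly. So this one spans the whole loop and is a pair of \<open>H\<close> with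
      one period fewer.\<close>
    have big: "s + N < t + N * k"
      using spliced_before_first_min[OF per S fm N k, of t] le tt False by linarith
    have val: "?S (u + N * k) = H (u + N * j)" if "t \<le> u" for u
    proof -
      have "u + N * k = (u + N * j) + N" by (simp add: j)
      moreover have "s \<le> u + N * j" using big j that by simp
      ultimately show ?thesis using spliced_high[OF per, of s "u + N * j" H] by metis
    qed
    have "H t' \<le> H (t' + N * j)"
      by (rule settledD[OF S tt]) (use le val[of t] tt False t' j in \<open>auto simp: spliced_low\<close>)
    then show ?thesis using val[OF tt] False by (simp add: spliced_low)
  qed
qed

section \<open>Converse: the first minimum and settledness are recovered from the spliced
  function\<close>

context
  fixes N M s :: nat and H G :: "nat \<Rightarrow> int"
  assumes per: "periodic N G" and N: "0 < N" and sM: "s \<le> M"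
    and S: "settled N (spliced N H G s) (M + N)"
    and before: "\<And>t. t < s \<Longrightarrow> spliced N H G s (t + N) < spliced N H G s t"
begin

lemma spliced_loop: "spliced N H G s (s + N) = spliced N H G s s"
  using spliced_high[OF per, where p = s and s = s] by (simp add: spliced_low)

lemma spliced_before_chain:
  assumes "0 < k" "t < s" "t + N * k \<le> s + N"
  shows "spliced N H G s (t + N * k) < spliced N H G s t"
  using assms
proof (induction k)
  case (Suc k)
  show ?case
  proof (cases "k = 0")
    case True
    then show ?thesis using before Suc by simp
  next
    case False
    \<comment> \<open>The last period may start at \<open>s\<close> itself, where the loop gives
      only equality; strictness comes from the earlier periods.\<close>
    have "spliced N H G s ((t + N * k) + N) \<le> spliced N H G s (t + N * k)"
      using Suc.prems before[of "t + N * k"] spliced_loop by (cases "t + N * k = s") auto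
    moreover have "spliced N H G s (t + N * k) < spliced N H G s t"
      using Suc False by auto
    ultimately show ?thesis by (simp add: algebra_simps)
  qed
qed simp

text \<open>The loop returns to its starting value, a nonnegative difference at \<open>s\<close>;
  settledness carries it to every later position, and the periods add up.\<close>

lemma spliced_after_chain:
  assumes "s \<le> t" "t + N * k \<le> M + N"
  shows "spliced N H G s t \<le> spliced N H G s (t + N * k)"
  using assms
proof (induction k)
  case (Suc k)
  have "spliced N H G s (t + N * k) \<le> spliced N H G s (t + N * k + N * 1)"
    by (rule settledD[OF S, of s]) (use Suc.prems spliced_loop in auto)
  with Suc show ?case by (simp add: algebra_simps)
qed simp

lemma spliced_first_min: "first_min (\<lambda>t. H t - G t) M s"
proof -
  have lt: "H s - G s < H t - G t" if t: "t < s" for t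
  proof -
    \<comment> \<open>The least number of periods that takes \<open>t\<close> to \<open>s\<close> or
      beyond, hence into the loop, where the value is \<open>H s + G t - G s\<close>.\<close>
    define k where "k = Suc ((s - t - 1) div N)"
    have "(s - t - 1) div N * N + (s - t - 1) mod N = s - t - 1" by (rule div_mult_mod_eq)
    moreover have "(s - t - 1) mod N < N" using N by simp
    moreover have "N * k = (s - t - 1) div N * N + N" by (simp add: k_def)
    moreover have "0 < k" by (simp add: k_def)
    ultimately have k: "s \<le> t + N * k" "t + N * k \<le> s + N" "0 < k" using t by linarith+
    have "spliced N H G s (t + N * k) < spliced N H G s t"
      using spliced_before_chain k t by blast
    then show ?thesis using k t by (simp add: spliced_mid spliced_low periodic_mult[OF per])
  qed
  have ge: "H s - G s \<le> H t - G t" if t: "s \<le> t" "t \<le> M" for t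
  proof -
    \<comment> \<open>The position in the loop congruent to \<open>t\<close> modulo
      \<open>N\<close>; it is \<open>k\<close> periods before \<open>t + N\<close>, the place to
      which splicing moves \<open>t\<close>.\<close>
    define u where "u = s + (t - s) mod N"
    define k where "k = Suc ((t - s) div N)"
    have "(t - s) div N * N + (t - s) mod N = t - s" by (rule div_mult_mod_eq)
    moreover have "N * k = (t - s) div N * N + N" by (simp add: k_def)
    ultimately have e: "u + N * k = t + N" using t unfolding u_def by linarith
    have u: "s \<le> u" "u \<le> s + N" using N by (auto simp: u_def less_imp_le)
    have "spliced N H G s u \<le> spliced N H G s (t + N)"
      using spliced_after_chain[of u k] u e t by simp
    then have "H s + G u - G s \<le> H t"
      using u t by (simp add: spliced_mid spliced_high[OF per])
    moreover have "G u = G t" using periodic_mult[OF per, of u k] e per unfolding periodic_def by metis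
    ultimately show ?thesis by simp
  qed
  show ?thesis unfolding first_min_def
    using sM lt ge by (metis less_imp_le not_le)
qed

text \<open>Pairs from \<open>s\<close> on are shifted by one loop and follow from the chain of
  periods. A nondecreasing pair starting before \<open>s\<close> must end after \<open>s\<close>, so
  in the spliced function it is a pair \<open>Suc k\<close> periods apart.\<close>

lemma settled_unspliced: "settled N H M"
proof (rule settledI)
  fix k t t' :: nat
  let ?S = "spliced N H G s"
  assume k: "0 < k" and tt: "t \<le> t'" and t': "t' + N * k \<le> M" and le: "H t \<le> H (t + N * k)"
  have high: "?S (u + N) = H u" if "s \<le> u" for u using spliced_high[OF per that] .
  show "H t' \<le> H (t' + N * k)"
  proof (cases "s \<le> t'")
    case True
    have "?S (t' + N) \<le> ?S (t' + N + N * k)" using True t' by (intro spliced_after_chain) auto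
    then show ?thesis using high[of t'] high[of "t' + N * k"] True by (simp add: algebra_simps)
  next
    case False
    have big: "s < t + N * k"
      using spliced_before_chain[OF k, of t] le tt False
      by (cases "t + N * k \<le> s") (auto simp: spliced_low)
    have val: "?S (u + N * Suc k) = H (u + N * k)" if "t \<le> u" for u
      using high[of "u + N * k"] big that by (simp add: algebra_simps)
    have "?S t' \<le> ?S (t' + N * Suc k)"
      by (rule settledD[OF S tt]) (use le tt False t' val[of t] in \<open>auto simp: spliced_low\<close>)
    then show ?thesis using val[OF tt] False by (simp add: spliced_low)
  qed
qed

end

section \<open>Prefix sums of words and rotations of loops\<close>

lemma height_0 [simp]: "height w 0 = 0"
  by (simp add: height_def)

lemma height_Suc: "height w (Suc t) = height w t + w ! t"
  by (simp add: height_def)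

lemma height_length: "height w (length w) = sum_list w"
  by (simp add: height_def sum_list_sum_nth atLeast0LessThan)

lemma sum_list_take_drop:
  "i + k \<le> length w \<Longrightarrow> sum_list (take k (drop i w)) = height w (i + k) - height w i"
proof (induction k)
  case (Suc k)
  then have "take (Suc k) (drop i w) = take k (drop i w) @ [w ! (i + k)]"
    by (subst take_Suc_conv_app_nth) auto
  with Suc show ?case by (simp add: height_Suc)
qed simp

lemma periodic_periodic_height:
  assumes "sum_list g = 0"
  shows "periodic (length g) (periodic_height g)"
  unfolding periodic_def
proof
  fix t
  show "periodic_height g (t + length g) = periodic_height g t"
  proof (induction t)
    case 0
    have "periodic_height g (length g) = height g (length g)"
      unfolding periodic_height_def height_def by (intro sum.cong) auto
    then show ?case using assms by (simp add: height_length periodic_height_def)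
  next
    case (Suc t)
    then show ?case by (simp add: periodic_height_def)
  qed
qed

lemma height_insert_loop:
  assumes "s \<le> length w" "sum_list g = 0" "p \<le> length w + length g"
  shows "height (insert_loop s g w) p
    = spliced (length g) (height w) (periodic_height g) s p"
  using assms(3)
proof (induction p)
  case 0
  then show ?case by (simp add: spliced_def)
next
  case (Suc p)
  note per = periodic_periodic_height[OF assms(2)]
  let ?N = "length g"
  have G: "periodic_height g (Suc p) = periodic_height g p + g ! (p mod ?N)"
    by (simp add: periodic_height_def)
  consider "p < s" | "s \<le> p" "p < s + ?N" | "s + ?N \<le> p" by linarith
  then show ?case
  proof cases
    case 1
    then have "insert_loop s g w ! p = w ! p"
      using assms(1) by (simp add: insert_loop_def nth_append)
    then show ?thesis using 1 Suc by (simp add: height_Suc spliced_low)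
  next
    case 2
    then have "p - s < ?N" by linarith
    then have "insert_loop s g w ! p = g ! (p mod ?N)"
      using 2 assms(1) by (simp add: insert_loop_def nth_append nth_rotate)
    then show ?thesis using 2 Suc G by (simp add: height_Suc spliced_mid)
  next
    case 3
    define q where "q = p - ?N"
    have q: "p = q + ?N" "s \<le> q" using 3 by (auto simp: q_def)
    then have "\<not> q + ?N - s < ?N" by linarith
    with q have "insert_loop s g w ! p = w ! q"
      using assms(1) Suc.prems by (simp add: insert_loop_def nth_append)
    then show ?thesis
      using q Suc spliced_high[OF per, of s q]
        spliced_high[OF per, of s "Suc q"]
      by (simp add: height_Suc)
  qed
qed

lemma rotate_length_mult: "rotate (length g * k) g = g"
  by (simp add: rotate_conv_mod[of "length g * k"])

lemma rotate_injective:
  assumes "rotate s g = rotate s h"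
  shows "g = h"
proof -
  have len: "length g = length h" using assms by (metis length_rotate)
  show ?thesis
  proof (cases "g = []")
    case False
    define m where "m = length g * s - s"
    have m: "m + s = length g * s" using False by (cases "length g") (auto simp: m_def)
    have "rotate m (rotate s g) = g"
      by (simp add: rotate_rotate m rotate_length_mult)
    moreover have "rotate m (rotate s h) = h"
      by (simp add: rotate_rotate m len rotate_length_mult)
    ultimately show ?thesis using assms by metis
  qed (use len in simp)
qed

lemma sum_list_rotate: "sum_list (rotate s (g :: int list)) = sum_list g"
proof -
  have "sum_list g = sum_list (take k g) + sum_list (drop k g)" for k
    by (metis append_take_drop_id sum_list_append)
  then show ?thesis by (simp add: rotate_drop_take add.commute)
qed

section \<open>Words without illegal subwords are the settled ones\<close>

definition loops :: "nat \<Rightarrow> nat \<Rightarrow> int list set" where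
  "loops a b = {g \<in> words a b. length g = a + b \<and> sum_list g = 0}"

definition settled_words :: "nat \<Rightarrow> nat \<Rightarrow> nat \<Rightarrow> int list set" where
  "settled_words a b n = {w \<in> words a b. length w = (a + b) * n \<and> sum_list w = 0 \<and>
     settled (a + b) (height w) ((a + b) * n)}"


lemma words_nth: "w \<in> words a b \<Longrightarrow> i < length w \<Longrightarrow> w ! i = int a \<or> w ! i = - int b"
  unfolding words_def using nth_mem[of i w] by auto

text \<open>Both letters are congruent to \<open>a\<close> modulo \<open>a + b\<close>, because
  \<open>- b = a - (a + b)\<close>.\<close>

lemma height_mod:
  assumes "w \<in> words a b" "t \<le> length w"
  shows "int (a + b) dvd height w t - int a * int t"
  using assms(2)
proof (induction t)
  case (Suc t)
  have "w ! t = int a \<or> w ! t = - int b"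
    using words_nth[OF assms(1)] Suc.prems by simp
  then have "int (a + b) dvd w ! t - int a"
  proof
    assume "w ! t = - int b"
    then have "w ! t - int a = int (a + b) * (- 1)" by simp
    then show ?thesis by (metis dvd_triv_left)
  qed simp
  moreover have "height w (Suc t) - int a * int (Suc t)
      = (height w t - int a * int t) + (w ! t - int a)"
    by (simp add: height_Suc algebra_simps)
  ultimately show ?case using Suc by (simp add: dvd_add)
qed simp

lemma height_diff_dvd:
  assumes "w \<in> words a b" "t + (a + b) * k \<le> length w"
  shows "int (a + b) dvd height w (t + (a + b) * k) - height w t"
proof -
  have "int (a + b) dvd (height w (t + (a + b) * k) - int a * int (t + (a + b) * k))
      - (height w t - int a * int t)"
    using assms by (intro dvd_diff height_mod) auto
  moreover have "height w (t + (a + b) * k) - height w t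
      = ((height w (t + (a + b) * k) - int a * int (t + (a + b) * k))
      - (height w t - int a * int t)) + int (a + b) * (int a * int k)"
    by (simp add: algebra_simps)
  ultimately show ?thesis by (metis dvd_add dvd_triv_left)
qed

text \<open>Coprimality enters here: \<open>a + b\<close> divides \<open>a * (t' - t)\<close> and is
  coprime to \<open>a\<close>.\<close>

lemma height_return_period:
  assumes "w \<in> words a b" "coprime a b" "t \<le> t'" "t' \<le> length w" "height w t = height w t'"
  shows "(a + b) dvd t' - t"
proof -
  have "int (a + b) dvd (height w t - int a * int t) - (height w t' - int a * int t')"
    using assms by (intro dvd_diff height_mod) auto
  then have "int (a + b) dvd int (a * (t' - t))"
    using assms by (simp add: of_nat_diff algebra_simps)
  then have "(a + b) dvd a * (t' - t)" by (simp only: int_dvd_int_iff)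
  moreover have "coprime (a + b) a" using assms(2)
    by (simp add: coprime_iff_gcd_eq_1 gcd.commute[of "a + b"])
  ultimately show ?thesis by (simp add: coprime_dvd_mult_right_iff)
qed

text \<open>An illegal subword starts with \<open>a\<close> and is followed by \<open>- b\<close>,
  so moving its window one letter on turns the difference 0 into \<open>- (a + b)\<close>.
  Conversely, a difference that turns negative was exactly 0 just before, and the two letters
  involved are \<open>a\<close> and \<open>- b\<close>.\<close>

lemma no_illegal_iff_settled:
  assumes w: "w \<in> words a b" and ab: "0 < a" "coprime a b"
  shows "(\<nexists>i j. illegal_at a b w i j) \<longleftrightarrow> settled (a + b) (height w) (length w)"
proof
  assume S: "settled (a + b) (height w) (length w)"
  show "\<nexists>i j. illegal_at a b w i j"
  proof
    assume "\<exists>i j. illegal_at a b w i j"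
    then obtain i j where ij: "i \<le> j" "sum_list (take (Suc j - i) (drop i w)) = 0"
      "w ! i = int a" "Suc j < length w" "w ! Suc j = - int b"
      unfolding illegal_at_def zero_sum_def subword_def by blast
    have e: "height w i = height w (Suc j)"
      using ij sum_list_take_drop[of i "Suc j - i" w] by simp
    then have "(a + b) dvd Suc j - i" using ij by (intro height_return_period[OF w ab(2)]) auto
    then obtain k where "Suc j - i = (a + b) * k" by blast
    then have k: "Suc j = i + (a + b) * k" using ij by simp
    have "Suc i + (a + b) * k \<le> length w" "height w i \<le> height w (i + (a + b) * k)"
      using ij(4) e unfolding k by simp_all
    then have "height w (Suc i) \<le> height w (Suc i + (a + b) * k)"
      using settledD[OF S, of i "Suc i" k] by simp
    moreover have "height w (Suc i + (a + b) * k) = height w i - int b"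
      using e ij(5) unfolding k by (simp add: height_Suc)
    ultimately show False using ij(3) ab by (simp add: height_Suc)
  qed
next
  assume L: "\<nexists>i j. illegal_at a b w i j"
  show "settled (a + b) (height w) (length w)"
  proof (rule settledI)
    fix k t t' :: nat
    let ?H = "height w" and ?N = "a + b"
    assume k: "0 < k" and tt: "t \<le> t'" and t': "t' + ?N * k \<le> length w"
      and le: "?H t \<le> ?H (t + ?N * k)"
    from tt t' show "?H t' \<le> ?H (t' + ?N * k)"
    proof (induction t' rule: dec_induct)
      case base
      show ?case by (rule le)
    next
      case (step u)
      let ?v = "u + ?N * k"
      have IH: "?H u \<le> ?H ?v" using step by simp
      have v: "?v < length w" using step.prems by simp
      have pos: "0 < ?N * k" using k ab by simp
      have letter: "w ! i = int a \<or> w ! i = - int b" if "i < length w" for i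
        using words_nth[OF w that] .
      show ?case
      proof (rule ccontr)
        assume "\<not> ?thesis"
        then have lt: "?H ?v + w ! ?v < ?H u + w ! u" by (simp add: height_Suc)
        then have wl: "w ! ?v = - int b" "w ! u = int a"
          using IH v letter[of ?v] letter[of u] by auto
        \<comment> \<open>The difference lies in \<open>[0, ?N)\<close> and is divisible by
          \<open>?N\<close>, so it vanishes.\<close>
        have "int ?N dvd ?H ?v - ?H u" using v by (intro height_diff_dvd[OF w]) simp
        moreover have "?H ?v - ?H u < int ?N" using lt wl by simp
        ultimately have e: "?H ?v = ?H u" using IH
          using zdvd_not_zless[of "?H ?v - ?H u" "int ?N"] by linarith
        have "sum_list (take (?N * k) (drop u w)) = 0"
          using e v sum_list_take_drop[of u "?N * k" w] by simp
        moreover have "Suc (?v - 1) - u = ?N * k" "Suc (?v - 1) = ?v" "u \<le> ?v - 1"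
          using pos by linarith+
        \<comment> \<open>The last index of the subword is \<open>?v - 1\<close>; the offending
          letter \<open>- b\<close> stands at \<open>?v\<close>.\<close>
        ultimately have "illegal_at a b w u (?v - 1)"
          using wl v unfolding illegal_at_def zero_sum_def subword_def by simp
        then show False using L by blast
      qed
    qed
  qed
qed

section \<open>The bijection that adds one loop\<close>

definition loop_position :: "nat \<Rightarrow> int list \<times> int list \<Rightarrow> nat" where
  "loop_position M = (\<lambda>(w, g). SOME s. first_min (\<lambda>t. height w t - periodic_height g t) M s)"

lemma first_min_loop_position:
  "first_min (\<lambda>t. height w t - periodic_height g t) M (loop_position M (w, g))"
  unfolding loop_position_def by (simp add: someI_ex[OF ex_first_min])

text \<open>The last two conclusions identify \<open>s\<close> from the new word alone, as the first
  position where the height does not drop over the next \<open>a + b\<close> letters.\<close>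

lemma insert_loop_settled:
  assumes ab: "0 < a" and w: "w \<in> settled_words a b n" and g: "g \<in> loops a b"
    and fm: "first_min (\<lambda>t. height w t - periodic_height g t) ((a + b) * n) s"
  shows "insert_loop s g w \<in> settled_words a b (Suc n)"
    and "\<And>t. t < s \<Longrightarrow>
      height (insert_loop s g w) (t + (a + b)) < height (insert_loop s g w) t"
    and "height (insert_loop s g w) (s + (a + b)) = height (insert_loop s g w) s"
proof -
  let ?N = "a + b" and ?v = "insert_loop s g w"
  let ?S = "spliced ?N (height w) (periodic_height g) s"
  have sM: "s \<le> ?N * n" using fm unfolding first_min_def by simp
  have lw: "length w = ?N * n" "w \<in> words a b" "sum_list w = 0" and S: "settled ?N (height w) (?N * n)"
    using w unfolding settled_words_def by auto
  have lg: "length g = ?N" "g \<in> words a b" "sum_list g = 0" using g unfolding loops_def by auto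
  have per: "periodic ?N (periodic_height g)"
    using periodic_periodic_height[of g] lg by simp
  have hv: "height ?v p = ?S p" if "p \<le> ?N * n + ?N" for p
    using height_insert_loop[of s w g p] sM lw lg that by simp
  have N: "0 < ?N" using ab by simp
  have "settled ?N ?S (?N * n + ?N)" by (rule settled_spliced[OF per N S fm])
  then have "settled ?N (height ?v) (?N * n + ?N)"
    by (rule settled_cong[THEN iffD2, rotated]) (rule hv)
  moreover have "?v \<in> words a b"
    using lw(2) lg(2) unfolding words_def insert_loop_def
    by (auto simp: in_lists_conv_set dest: in_set_takeD in_set_dropD)
  moreover have "sum_list ?v = 0"
  proof -
    have "sum_list w = sum_list (take s w) + sum_list (drop s w)"
      by (metis append_take_drop_id sum_list_append)
    then show ?thesis using lw lg by (simp add: insert_loop_def sum_list_rotate)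
  qed
  moreover have "length ?v = ?N * n + ?N" using sM lw lg by (simp add: insert_loop_def)
  ultimately show "?v \<in> settled_words a b (Suc n)"
    unfolding settled_words_def by (simp add: algebra_simps)
  show "height ?v (t + ?N) < height ?v t" if "t < s" for t
    using spliced_before_first_min[OF per S fm N, of 1 t] that sM by (simp add: hv)
  show "height ?v (s + ?N) = height ?v s"
    using spliced_high[OF per, of s s] sM by (simp add: hv spliced_low)
qed

lemma insert_loop_inj:
  assumes "s \<le> length w" "s \<le> length w'" "length g = length g'"
    and "insert_loop s g w = insert_loop s g' w'"
  shows "w = w' \<and> g = g'"
proof -
  have "take s w = take s w' \<and> rotate s g @ drop s w = rotate s g' @ drop s w'"
    using assms unfolding insert_loop_def by (subst (asm) append_eq_append_conv) auto
  then have "take s w = take s w' \<and> rotate s g = rotate s g' \<and> drop s w = drop s w'"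
    using assms(3) by (subst (asm) append_eq_append_conv) auto
  then show ?thesis by (metis append_take_drop_id rotate_injective)
qed

lemma ex_insert_loop:
  assumes "0 < N" "s + N \<le> length v"
  shows "\<exists>w g. length g = N \<and> length w + N = length v \<and> set g \<subseteq> set v \<and> set w \<subseteq> set v \<and>
    sum_list g = height v (s + N) - height v s \<and> v = insert_loop s g w"
proof -
  define h where "h = take N (drop s v)"
  \<comment> \<open>\<open>N * s - s\<close> is congruent to \<open>- s\<close> modulo
    \<open>N\<close>, so this undoes the rotation by \<open>s\<close>.\<close>
  define g where "g = rotate (N * s - s) h"
  define w where "w = take s v @ drop (s + N) v"
  have lh: "length h = N" using assms by (simp add: h_def)
  have "rotate s g = h"
    using assms rotate_length_mult[of h s] by (simp add: g_def rotate_rotate lh)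
  moreover have "h @ drop (s + N) v = drop s v"
    unfolding h_def by (metis add.commute append_take_drop_id drop_drop)
  ultimately have "v = insert_loop s g w" using assms by (simp add: insert_loop_def w_def)
  moreover have "sum_list g = height v (s + N) - height v s"
    using assms by (simp add: g_def sum_list_rotate h_def sum_list_take_drop)
  moreover have "set g \<subseteq> set v" "set w \<subseteq> set v"
    by (auto simp: g_def h_def w_def dest: in_set_takeD in_set_dropD)
  moreover have "length g = N" "length w + N = length v" using assms by (auto simp: g_def lh w_def)
  ultimately show ?thesis by blast
qed

lemma ex_loop_in_settled_word:
  assumes ab: "0 < a" and v: "v \<in> settled_words a b (Suc n)"
  shows "\<exists>s\<le>(a + b) * n. height v (s + (a + b)) = height v s \<and>
    (\<forall>t<s. height v (t + (a + b)) < height v t)"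
proof -
  let ?N = "a + b"
  let ?H = "height v"
  have lv: "length v = ?N * n + ?N" "v \<in> words a b" "sum_list v = 0"
    and S: "settled ?N ?H (?N * n + ?N)"
    using v unfolding settled_words_def by (auto simp: algebra_simps)
  have top: "?H (?N * n + ?N) = 0" using height_length[of v] lv by simp
  \<comment> \<open>Strict drops everywhere would, in strides of \<open>?N\<close> from 0, make the
    total height negative.\<close>
  have ex: "\<exists>s. s \<le> ?N * n \<and> ?H s \<le> ?H (s + ?N)"
  proof (rule ccontr)
    assume "\<not> ?thesis"
    then have d: "?H (s + ?N) < ?H s" if "s \<le> ?N * n" for s using that by auto
    have "?H (?N * q + ?N) < 0" if "q \<le> n" for q using that
    proof (induction q)
      case 0
      then show ?case using d[of 0] by simp
    next
      case (Suc q)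
      then have "?N * Suc q \<le> ?N * n" by (intro mult_le_mono2)
      from d[OF this] show ?case using Suc by (simp add: algebra_simps)
    qed
    then show False using top by fastforce
  qed
  define s where "s = (LEAST s. s \<le> ?N * n \<and> ?H s \<le> ?H (s + ?N))"
  have s: "s \<le> ?N * n" "?H s \<le> ?H (s + ?N)" unfolding s_def using LeastI_ex[OF ex] by auto
  have before: "?H (t + ?N) < ?H t" if "t < s" for t
    using not_less_Least[OF that[unfolded s_def]] that s by auto
  have "?H (s + ?N) \<le> ?H s"
  proof (cases s)
    case 0
    \<comment> \<open>With no earlier position to compare with, settledness makes all later strides
      nonnegative, so \<open>?H ?N\<close> is at most the final height 0.\<close>
    have "?H ?N \<le> ?H (?N + ?N * q)" if "q \<le> n" for q using that
    proof (induction q)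
      case (Suc q)
      then have "?N * Suc q \<le> ?N * n" by (intro mult_le_mono2)
      then have "?N + ?N * q + ?N * 1 \<le> ?N * n + ?N" by simp
      then have "?H (?N + ?N * q) \<le> ?H (?N + ?N * q + ?N * 1)"
        using settledD[OF S le0] s(2) 0 by (metis add_0 mult.right_neutral)
      with Suc show ?case by (simp add: algebra_simps)
    qed simp
    from this[of n] show ?thesis using top 0 by (simp add: algebra_simps)
  next
    case (Suc r)
    have "?H (r + ?N * 1) < ?H r" using before Suc by simp
    moreover have "int ?N dvd ?H (r + ?N * 1) - ?H r"
      using Suc s lv by (intro height_diff_dvd) auto
    \<comment> \<open>A negative multiple of \<open>?N\<close> is at most \<open>- ?N\<close>; one
      letter further it has grown by at most \<open>?N\<close>, so it is not yet positive at
      \<open>s\<close>.\<close>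
    ultimately have "int ?N \<le> ?H r - ?H (r + ?N)"
      by (intro zdvd_imp_le) (auto simp: dvd_diff_commute)
    moreover have letter: "- int b \<le> v ! i \<and> v ! i \<le> int a" if "i < length v" for i
      using words_nth[OF lv(2) that] by auto
    moreover have "r < length v" "r + ?N < length v" using Suc s lv by auto
    ultimately have "?H (r + ?N) + v ! (r + ?N) \<le> ?H r + v ! r"
      using letter[of r] letter[of "r + ?N"] by linarith
    then show ?thesis using Suc by (simp add: height_Suc)
  qed
  then show ?thesis using s before by (intro exI[of _ s]) auto
qed

lemma settled_words_Suc_bij:
  assumes ab: "0 < a"
  shows "bij_betw (\<lambda>(w, g). insert_loop (loop_position ((a + b) * n) (w, g)) g w)
    (settled_words a b n \<times> loops a b) (settled_words a b (Suc n))"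
    (is "bij_betw ?f ?A ?B")
proof -
  let ?N = "a + b"
  let ?pos = "\<lambda>w g. loop_position (?N * n) (w, g)"
  have pos: "first_min (\<lambda>t. height w t - periodic_height g t) (?N * n) (?pos w g)" for w g
    by (rule first_min_loop_position)
  have pos_le: "?pos w g \<le> ?N * n" for w g using pos unfolding first_min_def by blast
  have "inj_on ?f ?A"
  proof (rule inj_onI, clarify)
    fix w g w' g'
    assume w: "w \<in> settled_words a b n" "w' \<in> settled_words a b n"
      and g: "g \<in> loops a b" "g' \<in> loops a b"
      and e: "insert_loop (?pos w g) g w = insert_loop (?pos w' g') g' w'"
    note i = insert_loop_settled(2,3)[OF ab w(1) g(1) pos]
    note i' = insert_loop_settled(2,3)[OF ab w(2) g(2) pos]
    \<comment> \<open>If one position were smaller, the common word would have both a strict drop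
      and equal heights there.\<close>
    have "?pos w g = ?pos w' g'"
      using i i' e by (metis linorder_neqE_nat less_irrefl)
    then show "w = w' \<and> g = g'"
      using e pos_le w g by (intro insert_loop_inj[of "?pos w g"]) (auto simp: settled_words_def loops_def)
  qed
  moreover have "?f ` ?A \<subseteq> ?B" using insert_loop_settled(1)[OF ab _ _ pos] by auto
  moreover have "?B \<subseteq> ?f ` ?A"
  proof
    fix v assume v: "v \<in> ?B"
    then have lv: "length v = ?N * n + ?N" "v \<in> words a b" "sum_list v = 0"
      and S: "settled ?N (height v) (?N * n + ?N)"
      unfolding settled_words_def by (auto simp: algebra_simps)
    obtain s where s: "s \<le> ?N * n" "height v (s + ?N) = height v s"
      and before: "\<And>t. t < s \<Longrightarrow> height v (t + ?N) < height v t"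
      using ex_loop_in_settled_word[OF ab v] by auto
    have N: "0 < ?N" using ab by simp
    obtain w g where wg: "length g = ?N" "length w + ?N = length v" "set g \<subseteq> set v" "set w \<subseteq> set v"
      "sum_list g = 0" "v = insert_loop s g w"
      using ex_insert_loop[OF N, of s v] s lv(1) by (metis add_le_mono1 diff_self)
    have lw: "length w = ?N * n" using wg lv by simp
    have per: "periodic ?N (periodic_height g)"
      using periodic_periodic_height[of g] wg by simp
    let ?S = "spliced ?N (height w) (periodic_height g) s"
    have hv: "height v p = ?S p" if "p \<le> ?N * n + ?N" for p
      using height_insert_loop[of s w g p] s lw wg that by simp
    have S': "settled ?N ?S (?N * n + ?N)"
      using S by (rule settled_cong[THEN iffD1, rotated]) (rule hv)
    have before': "?S (t + ?N) < ?S t" if "t < s" for t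
      using before[OF that] that s by (simp add: hv)
    have "settled ?N (height w) (?N * n)"
      by (rule settled_unspliced[OF per N s(1) S' before'])
    moreover have "sum_list w = 0"
    proof -
      have "sum_list w = sum_list (take s w) + sum_list (drop s w)"
        by (metis append_take_drop_id sum_list_append)
      then show ?thesis using lv wg by (simp add: insert_loop_def sum_list_rotate)
    qed
    moreover have "w \<in> words a b" "g \<in> words a b" using wg lv unfolding words_def by auto
    ultimately have mem: "(w, g) \<in> ?A"
      using lw wg unfolding settled_words_def loops_def by simp
    have "first_min (\<lambda>t. height w t - periodic_height g t) (?N * n) s"
      by (rule spliced_first_min[OF per N s(1) S' before'])
    then have "s = ?pos w g" using pos first_min_unique by blast
    then have "v = ?f (w, g)" using wg by simp
    then show "v \<in> ?f ` ?A" using mem by blast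
  qed
  ultimately show ?thesis unfolding bij_betw_def by blast
qed

section \<open>Counting loops and settled words\<close>

lemma card_loops:
  assumes "0 < a"
  shows "card (loops a b) = (a + b) choose a"
proof -
  let ?N = "a + b"
  let ?down = "\<lambda>g. {i. i < ?N \<and> g ! i = - int b}"
  let ?word = "\<lambda>A. map (\<lambda>i. if i \<in> A then - int b else int a) [0..<?N]"
  \<comment> \<open>Each letter \<open>- b\<close> is \<open>a\<close> lowered by \<open>?N\<close>.
    Hence the sum vanishes exactly when \<open>a\<close> of the letters are \<open>- b\<close>, and
    loops correspond to subsets of size \<open>a\<close>.\<close>
  have sum_word: "sum_list (?word A) = int ?N * (int a - int (card A))" if "A \<subseteq> {..<?N}" for A
  proof -
    have "sum_list (?word A) = (\<Sum>i<?N. if i \<in> A then - int b else int a)"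
      by (simp add: sum_list_sum_nth atLeast0LessThan)
    also have "\<dots> = (\<Sum>i<?N. int a - (if i \<in> A then int ?N else 0))"
      by (intro sum.cong) auto
    also have "\<dots> = int ?N * int a - int ?N * int (card A)"
      using that by (simp add: sum_subtractf sum.If_cases Int_absorb1)
    finally show ?thesis by (simp add: algebra_simps)
  qed
  have inv: "?word (?down g) = g" if "g \<in> words a b" "length g = ?N" for g
  proof (rule nth_equalityI)
    fix i assume "i < length (?word (?down g))"
    then have i: "i < ?N" by simp
    then have "g ! i = int a \<or> g ! i = - int b"
      using words_nth[OF that(1)] that(2) by simp
    then show "?word (?down g) ! i = g ! i" using i by auto
  qed (use that in simp)
  have "bij_betw ?down (loops a b) {A. A \<subseteq> {..<?N} \<and> card A = a}"
  proof (rule bij_betw_byWitness[where f' = ?word])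
    show "\<forall>g\<in>loops a b. ?word (?down g) = g" using inv unfolding loops_def by blast
    \<comment> \<open>Since \<open>a\<close> is positive, the letters \<open>a\<close> and
      \<open>- b\<close> differ, so \<open>A\<close> can be read off the word.\<close>
    show "\<forall>A\<in>{A. A \<subseteq> {..<?N} \<and> card A = a}. ?down (?word A) = A"
      using assms by (auto split: if_splits)
    show "?down ` loops a b \<subseteq> {A. A \<subseteq> {..<?N} \<and> card A = a}"
    proof clarify
      fix g assume "g \<in> loops a b"
      then have g: "g \<in> words a b" "length g = ?N" "sum_list g = 0" unfolding loops_def by auto
      have sub: "?down g \<subseteq> {..<?N}" by auto
      have "int ?N * (int a - int (card (?down g))) = 0"
        using sum_word[OF sub] inv[OF g(1,2)] g(3) by simp
      then show "?down g \<subseteq> {..<?N} \<and> card (?down g) = a" using sub assms by simp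
    qed
    show "?word ` {A. A \<subseteq> {..<?N} \<and> card A = a} \<subseteq> loops a b"
      using sum_word unfolding loops_def words_def by auto
  qed
  then show ?thesis using n_subsets[of "{..<?N}" a] by (simp add: bij_betw_same_card)
qed

lemma card_settled_words:
  assumes "0 < a"
  shows "card (settled_words a b n) = ((a + b) choose a) ^ n"
proof (induction n)
  case 0
  have "settled_words a b 0 = {[]}"
    unfolding settled_words_def settled_def words_def using assms by auto
  then show ?case by simp
next
  case (Suc n)
  have "card (settled_words a b (Suc n)) = card (settled_words a b n \<times> loops a b)"
    using bij_betw_same_card[OF settled_words_Suc_bij[OF assms]] by simp
  then show ?case using Suc card_loops[OF assms] by (simp add: card_cartesian_product)
qed

theorem theorem1:
  fixes a b n :: nat
  assumes "a > 0" and "b > 0" and "coprime a b"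
  shows "card {w \<in> words a b. length w = (a + b) * n \<and> zero_sum w \<and>
           (\<nexists>i j. illegal_at a b w i j)} = ((a + b) choose a) ^ n"
proof -
  have "{w \<in> words a b. length w = (a + b) * n \<and> zero_sum w \<and>
           (\<nexists>i j. illegal_at a b w i j)} = settled_words a b n"
    unfolding settled_words_def zero_sum_def
    using no_illegal_iff_settled[OF _ assms(1,3)] by (intro Collect_cong) metis
  then show ?thesis using card_settled_words[OF assms(1)] by simp
qed

end
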